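(* For an integer $n\ge 2$, let $T_n$ denote the set of all integers $x$ such that there exists a penult with exactly $x$ tokens on the $n\times n$ board of the dual game of Impartial Tic. Then $T_2=\{4\}$, $T_3=\{6\}$, $T_4=\{8,9\}$, and for every $n\ge 5$, $T_n=\{x\in\mathbb{Z} : 2n\le x\le 4(n-2)\}$.
   Context: Impartial game positions: a position is terminal if it has no options; it is an ult if it is not terminal but has a terminal option; it is a penult if it is not terminal and all of its options are ults. Impartial Tic: two players alternately place identical tokens on empty cells of an $n\times n$ grid; play ends as soon as some row or some column is completely filled. Dual game of Impartial Tic: the $n\times n$ board begins full of tokens (one per cell); players alternately remove one token from the board; the game ends (no further moves) as soon as some row or some column is empty. A position is thus the set of cells that currently contain tokens. Equivalently, a penult of the dual game is a set of tokens on the $n\times n$ board (at most one per cell) such that (i) every row and every column contains at least two tokens, and (ii) no token lies both in a row with at least $3$ tokens and in a column with at least $3$ tokens. *)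

theory Defs
  imports Main
begin

text \<open>An impartial game is given by the function sending each position to its set of options.\<close>

definition terminal :: "('p \<Rightarrow> 'p set) \<Rightarrow> 'p \<Rightarrow> bool" where
  "terminal opts p \<longleftrightarrow> opts p = {}"

definition ult :: "('p \<Rightarrow> 'p set) \<Rightarrow> 'p \<Rightarrow> bool" where
  "ult opts p \<longleftrightarrow> \<not> terminal opts p \<and> (\<exists>q\<in>opts p. terminal opts q)"

definition penult :: "('p \<Rightarrow> 'p set) \<Rightarrow> 'p \<Rightarrow> bool" where
  "penult opts p \<longleftrightarrow> \<not> terminal opts p \<and> (\<forall>q\<in>opts p. ult opts q)"

text \<open>A cell is a pair (row, column), with both indices ranging over 0, ..., n - 1.
  A position of the dual game is the set of cells that contain a token.\<close>

type_synonym cell = "nat \<times> nat"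

definition board :: "nat \<Rightarrow> cell set" where
  "board n = {..<n} \<times> {..<n}"

definition some_line_empty :: "nat \<Rightarrow> cell set \<Rightarrow> bool" where
  "some_line_empty n P \<longleftrightarrow>
     (\<exists>i<n. \<forall>j<n. (i, j) \<notin> P) \<or> (\<exists>j<n. \<forall>i<n. (i, j) \<notin> P)"

definition dual_tic_moves :: "nat \<Rightarrow> cell set \<Rightarrow> cell set set" where
  "dual_tic_moves n P = (if some_line_empty n P then {} else {P - {c} | c. c \<in> P})"

definition penult_sizes :: "nat \<Rightarrow> int set" where
  "penult_sizes n = {x. \<exists>P. P \<subseteq> board n \<and> penult (dual_tic_moves n) P \<and> x = int (card P)}"

end

theory Submission
  imports Defs
begin

text \<open>
  Read a set of tokens as a bipartite graph between rows and columns, a token being an edge. A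
  position is a penult exactly when every line has degree at least 2 and every token lies in a line
  of degree exactly 2, a \<^emph>\<open>light\<close> line (lemma \<open>penult_iff_config\<close>). The theorem is then a question
  about edge numbers.

  Summing degrees over rows gives at least \<open>2 n\<close> tokens, with equality when all rows are light;
  by transposition the size is also \<open>2 n\<close> when all columns are light.
  Tokens are covered by light lines, each of which carries two of them, so with at least two heavy
  rows and two heavy columns there are at most \<open>4 (n - 2)\<close> tokens. If there is a single heavy row
  and at least one heavy column, the tokens of that row sit in light columns, whence at most
  \<open>2 (n - 1) + (n - 1)\<close> tokens (lemma \<open>config_card_cases\<close>). The value \<open>3 (n - 1)\<close> exceeds
  \<open>max (2 n) (4 (n - 2))\<close> only for \<open>n = 4\<close>, which is where the exceptional size 9 comes from.

  Conversely, let rows 0, 1 and columns 0, 1 be heavy, put a token at every crossing of a heavy line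
  with a light line, and nothing else: \<open>4 (n - 2)\<close> tokens. Exchanging the two tokens \<open>(i, h)\<close> and
  \<open>(h, j)\<close>, where \<open>h < 2\<close> is heavy and \<open>i\<close>, \<open>j\<close> are light, for the single token \<open>(i, j)\<close> preserves
  the degrees of the light lines and lowers the total by 1. Up to \<open>n - 4\<close> exchanges are possible
  for each of \<open>h = 0\<close> and \<open>h = 1\<close> before a line \<open>h\<close> falls below degree 2, which reaches every size
  down to \<open>2 n\<close> (lemma \<open>config_layout\<close>).
\<close>

section \<open>Penults as degree conditions\<close>

text \<open>The row \<open>i\<close> of \<open>P\<close> is the relational image \<open>P `` {i}\<close>, and the column \<open>j\<close> is
  \<open>P\<inverse> `` {j}\<close>; transposing the board is thus taking the converse.\<close>

definition penult_config :: "nat \<Rightarrow> cell set \<Rightarrow> bool" where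
  "penult_config n P \<longleftrightarrow> P \<subseteq> board n \<and>
     (\<forall>i<n. 2 \<le> card (P `` {i})) \<and> (\<forall>j<n. 2 \<le> card (P\<inverse> `` {j})) \<and>
     (\<forall>(i, j)\<in>P. card (P `` {i}) = 2 \<or> card (P\<inverse> `` {j}) = 2)"

lemma penult_config_converse: "penult_config n P \<Longrightarrow> penult_config n (P\<inverse>)"
  unfolding penult_config_def board_def by auto

lemma finite_board_subset:
  assumes "P \<subseteq> board n"
  shows "finite P" "finite (P `` {i})" "finite (P\<inverse> `` {j})"
proof -
  show "finite P"
    using assms finite_subset unfolding board_def by blast
  then show "finite (P `` {i})" "finite (P\<inverse> `` {j})"
    by (auto intro: finite_Image)
qed

lemma some_line_empty_iff:
  "some_line_empty n P \<longleftrightarrow> (\<exists>i<n. \<forall>j<n. (i, j) \<notin> P) \<or> (\<exists>i<n. \<forall>j<n. (i, j) \<notin> P\<inverse>)"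
  unfolding some_line_empty_def by auto

lemma some_line_empty_converse: "some_line_empty n (P\<inverse>) = some_line_empty n P"
  unfolding some_line_empty_iff by auto

lemma terminal_dual_tic_iff:
  assumes "n > 0"
  shows "terminal (dual_tic_moves n) P \<longleftrightarrow> some_line_empty n P"
  using assms unfolding terminal_def dual_tic_moves_def some_line_empty_def by auto

lemma penult_dual_tic_iff:
  assumes "n > 0"
  shows "penult (dual_tic_moves n) P \<longleftrightarrow> \<not> some_line_empty n P \<and>
    (\<forall>c\<in>P. \<not> some_line_empty n (P - {c}) \<and> (\<exists>d\<in>P - {c}. some_line_empty n (P - {c} - {d})))"
proof (cases "some_line_empty n P")
  case True
  then show ?thesis unfolding penult_def terminal_dual_tic_iff[OF assms] by simp
next
  case False
  have moves: "dual_tic_moves n Q = (\<lambda>c. Q - {c}) ` Q" if "\<not> some_line_empty n Q" for Q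
    using that unfolding dual_tic_moves_def by auto
  have ult: "ult (dual_tic_moves n) Q \<longleftrightarrow>
      \<not> some_line_empty n Q \<and> (\<exists>d\<in>Q. some_line_empty n (Q - {d}))" for Q
  proof (cases "some_line_empty n Q")
    case True
    then show ?thesis unfolding ult_def terminal_dual_tic_iff[OF assms] by simp
  next
    case False
    then show ?thesis
      unfolding ult_def terminal_dual_tic_iff[OF assms] moves[OF False] bex_simps by simp
  qed
  show ?thesis
    unfolding penult_def terminal_dual_tic_iff[OF assms] moves[OF False] ball_simps ult
    by (simp only: False simp_thms)
qed

lemma row_card_ge_2_of_penult:
  assumes "P \<subseteq> board n" "\<not> some_line_empty n P" "\<forall>c\<in>P. \<not> some_line_empty n (P - {c})" "i < n"
  shows "2 \<le> card (P `` {i})"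
proof -
  obtain j where j: "(i, j) \<in> P"
    using assms(2,4) unfolding some_line_empty_def by blast
  with assms(3,4) obtain j' where "(i, j') \<in> P - {(i, j)}"
    unfolding some_line_empty_def by blast
  with j have "{j, j'} \<subseteq> P `` {i}" "j \<noteq> j'" by auto
  with card_mono[OF finite_board_subset(2)[OF assms(1)], of "{j, j'}" i] show ?thesis by simp
qed

text \<open>If every row has at least two tokens, then emptying row \<open>i\<close> takes two removals inside that
  row, so both removed tokens lie in it and nothing else does.\<close>

lemma row_emptied_by_two:
  assumes "\<forall>i<n. 2 \<le> card (P `` {i})" "P \<subseteq> board n"
    and "i < n" "\<forall>j<n. (i, j) \<notin> P - {c} - {d}"
  shows "fst c = i \<and> card (P `` {i}) = 2"
proof -
  have "P `` {i} \<subseteq> (if fst c = i then {snd c, snd d} else {snd d})"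
  proof
    fix j
    assume "j \<in> P `` {i}"
    then have "(i, j) = c \<or> (i, j) = d"
      using assms(2,4) unfolding board_def by auto
    then show "j \<in> (if fst c = i then {snd c, snd d} else {snd d})" by auto
  qed
  then have "card (P `` {i}) \<le> card (if fst c = i then {snd c, snd d} else {snd d})"
    by (rule card_mono[rotated]) simp
  also have "\<dots> \<le> (if fst c = i then 2 else 1)"
    by (simp add: card_insert_if)
  finally show ?thesis using assms(1,3) by (auto split: if_splits)
qed

lemma row_survives_removal:
  assumes "2 \<le> card (P `` {i})" "P \<subseteq> board n"
  shows "\<exists>j<n. (i, j) \<in> P - {c}"
proof -
  have "\<not> P `` {i} \<subseteq> {snd c}"
    using card_mono[of "{snd c}" "P `` {i}"] assms(1) by auto
  then obtain j where "(i, j) \<in> P" "j \<noteq> snd c" by auto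
  then show ?thesis using assms(2) unfolding board_def by auto
qed

lemma light_row_removal:
  assumes "(i, j) \<in> P" "card (P `` {i}) = 2" "P \<subseteq> board n"
  shows "\<exists>d\<in>P - {(i, j)}. some_line_empty n (P - {(i, j)} - {d})"
proof -
  have "j \<in> P `` {i}" using assms(1) by simp
  with assms(2) have "card (P `` {i} - {j}) = 1" by simp
  then obtain j' where j': "P `` {i} - {j} = {j'}" by (rule card_1_singletonE)
  then have *: "(i, j') \<in> P - {(i, j)}" by auto
  have "i < n" using assms(1,3) unfolding board_def by auto
  moreover have "\<forall>k<n. (i, k) \<notin> P - {(i, j)} - {(i, j')}" using j' by auto
  ultimately show ?thesis
    unfolding some_line_empty_def using * by blast
qed

lemma penult_iff_config:
  assumes "n > 0" and sub: "P \<subseteq> board n"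
  shows "penult (dual_tic_moves n) P \<longleftrightarrow> penult_config n P"
proof
  have sub': "P\<inverse> \<subseteq> board n" using sub unfolding board_def by auto
  {
    assume "penult (dual_tic_moves n) P"
    then have ne: "\<not> some_line_empty n P"
      and ne1: "\<forall>c\<in>P. \<not> some_line_empty n (P - {c})"
      and ult: "\<forall>c\<in>P. \<exists>d\<in>P - {c}. some_line_empty n (P - {c} - {d})"
      unfolding penult_dual_tic_iff[OF assms(1)] by blast+
    have rows: "\<forall>i<n. 2 \<le> card (P `` {i})"
      using row_card_ge_2_of_penult[OF sub ne ne1] by blast
    have "\<not> some_line_empty n (P\<inverse> - {c})" if "c \<in> P\<inverse>" for c
    proof -
      obtain a b where c: "c = (a, b)" by (cases c)
      then have "P\<inverse> - {c} = (P - {(b, a)})\<inverse>" by auto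
      then show ?thesis using ne1 that c some_line_empty_converse by auto
    qed
    then have cols: "\<forall>j<n. 2 \<le> card (P\<inverse> `` {j})"
      using row_card_ge_2_of_penult[OF sub'] ne some_line_empty_converse by blast
    have "card (P `` {i}) = 2 \<or> card (P\<inverse> `` {j}) = 2" if ij: "(i, j) \<in> P" for i j
    proof -
      obtain a b where "some_line_empty n (P - {(i, j)} - {(a, b)})"
        using bspec[OF ult ij] by auto
      then consider k where "k < n" "\<forall>l<n. (k, l) \<notin> P - {(i, j)} - {(a, b)}"
        | k where "k < n" "\<forall>l<n. (k, l) \<notin> P\<inverse> - {(j, i)} - {(b, a)}"
        unfolding some_line_empty_iff by auto
      then show ?thesis
      proof cases
        case 1
        then show ?thesis using row_emptied_by_two[OF rows sub 1] by simp
      next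
        case 2
        then show ?thesis using row_emptied_by_two[OF cols sub' 2] by simp
      qed
    qed
    then show "penult_config n P"
      using sub rows cols unfolding penult_config_def by auto
  }
  {
    assume cfg: "penult_config n P"
    have surv: "\<not> some_line_empty n (P - {c})" for c
    proof -
      obtain a b where c: "c = (a, b)" by (cases c)
      have rows: "\<exists>j<n. (i, j) \<in> P - {c}" if "i < n" for i
        using row_survives_removal[OF _ sub] cfg that unfolding penult_config_def by blast
      have cols: "\<exists>j<n. (i, j) \<in> P\<inverse> - {(b, a)}" if "i < n" for i
        using row_survives_removal[OF _ sub'] cfg that unfolding penult_config_def by blast
      have "P\<inverse> - {(b, a)} = (P - {c})\<inverse>" unfolding c by auto
      with rows cols show ?thesis unfolding some_line_empty_iff by metis
    qed
    then have "\<not> some_line_empty n P"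
      unfolding some_line_empty_def by blast
    moreover have "\<exists>d\<in>P - {c}. some_line_empty n (P - {c} - {d})" if cP: "c \<in> P" for c
    proof -
      obtain i j where c: "c = (i, j)" by (cases c)
      consider "card (P `` {i}) = 2" | "card (P\<inverse> `` {j}) = 2"
        using cfg cP c unfolding penult_config_def by blast
      then show ?thesis
      proof cases
        case 1
        then show ?thesis using light_row_removal[OF _ _ sub] cP c by blast
      next
        case 2
        then obtain a b where d: "(a, b) \<in> P\<inverse> - {(j, i)}"
          "some_line_empty n (P\<inverse> - {(j, i)} - {(a, b)})"
          using light_row_removal[of j i "P\<inverse>", OF _ 2 sub'] cP c by auto
        have "P\<inverse> - {(j, i)} - {(a, b)} = (P - {(i, j)} - {(b, a)})\<inverse>" by auto
        with d(2) have "some_line_empty n (P - {c} - {(b, a)})"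
          using some_line_empty_converse c by simp
        with d(1) c show ?thesis by (intro bexI[of _ "(b, a)"]) auto
      qed
    qed
    ultimately show "penult (dual_tic_moves n) P"
      unfolding penult_dual_tic_iff[OF assms(1)] using surv by blast
  }
qed

lemma penult_sizes_eq:
  assumes "n > 0"
  shows "penult_sizes n = {int (card P) | P. penult_config n P}"
proof -
  have "P \<subseteq> board n \<and> penult (dual_tic_moves n) P \<longleftrightarrow> penult_config n P" for P
    using penult_iff_config[OF assms, of P] penult_config_def[of n P] by metis
  then show ?thesis unfolding penult_sizes_def by blast
qed

section \<open>Bounds on the number of tokens\<close>

definition light_rows :: "nat \<Rightarrow> cell set \<Rightarrow> nat set" where
  "light_rows n P = {i\<in>{..<n}. card (P `` {i}) = 2}"

lemma light_rows_basics [simp]: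
  "finite (light_rows n P)" "light_rows n P \<subseteq> {..<n}" "card (light_rows n P) \<le> n"
proof -
  show sub: "light_rows n P \<subseteq> {..<n}" unfolding light_rows_def by auto
  then show "finite (light_rows n P)" using finite_subset by blast
  show "card (light_rows n P) \<le> n" using card_mono[OF _ sub] by simp
qed

lemma card_eq_sum_rows:
  assumes "P \<subseteq> board n"
  shows "card P = (\<Sum>i<n. card (P `` {i}))"
proof -
  have "P = Sigma {..<n} (\<lambda>i. P `` {i})"
    using assms unfolding board_def by auto
  then have "card P = card (Sigma {..<n} (\<lambda>i. P `` {i}))" by simp
  also have "\<dots> = (\<Sum>i<n. card (P `` {i}))"
    using finite_board_subset(2)[OF assms] by (intro card_SigmaI) auto
  finally show ?thesis .
qed

lemma card_split_light_rows:
  assumes "P \<subseteq> board n"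
  shows "card P = 2 * card (light_rows n P) + (\<Sum>i\<in>{..<n} - light_rows n P. card (P `` {i}))"
proof -
  have "card P = (\<Sum>i\<in>light_rows n P. card (P `` {i})) +
      (\<Sum>i\<in>{..<n} - light_rows n P. card (P `` {i}))"
    unfolding card_eq_sum_rows[OF assms]
    by (subst sum.subset_diff[of "light_rows n P"]) auto
  also have "(\<Sum>i\<in>light_rows n P. card (P `` {i})) = 2 * card (light_rows n P)"
    by (simp add: light_rows_def)
  finally show ?thesis .
qed

lemma config_card_ge:
  assumes "penult_config n P"
  shows "2 * n \<le> card P"
proof -
  have "(\<Sum>i<n. 2) \<le> (\<Sum>i<n. card (P `` {i}))"
    using assms unfolding penult_config_def by (intro sum_mono) auto
  then show ?thesis
    using card_eq_sum_rows[of P n] assms unfolding penult_config_def by simp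
qed

lemma card_all_rows_light:
  assumes "penult_config n P" "card (light_rows n P) = n"
  shows "card P = 2 * n"
proof -
  have "light_rows n P = {..<n}"
    by (rule card_subset_eq) (simp_all add: assms(2))
  then show ?thesis
    using card_split_light_rows[of P n] assms unfolding penult_config_def by simp
qed

text \<open>The tokens of the only heavy row occupy light columns, of which there are at most \<open>n - 1\<close>.\<close>

lemma card_one_heavy_row:
  assumes cfg: "penult_config n P"
    and rows: "Suc (card (light_rows n P)) = n" and cols: "card (light_rows n (P\<inverse>)) < n"
  shows "card P \<le> 3 * (n - 1)"
proof -
  have sub: "P \<subseteq> board n" using cfg unfolding penult_config_def by blast
  have "card ({..<n} - light_rows n P) = 1"
    using rows by (subst card_Diff_subset) auto
  then obtain h where h: "{..<n} - light_rows n P = {h}"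
    by (auto simp: card_1_singleton_iff)
  then have "card (P `` {h}) \<noteq> 2" unfolding light_rows_def by auto
  then have "P `` {h} \<subseteq> light_rows n (P\<inverse>)"
    using cfg sub unfolding penult_config_def light_rows_def board_def by fastforce
  then have "card (P `` {h}) \<le> card (light_rows n (P\<inverse>))"
    by (rule card_mono[rotated]) simp
  with card_split_light_rows[OF sub] h rows cols show ?thesis by simp
qed

lemma card_le_light_lines:
  assumes cfg: "penult_config n P"
  shows "card P \<le> 2 * card (light_rows n P) + 2 * card (light_rows n (P\<inverse>))"
proof -
  let ?A = "light_rows n P" and ?B = "light_rows n (P\<inverse>)"
  let ?R = "Sigma ?A (\<lambda>i. P `` {i})" and ?C = "Sigma ?B (\<lambda>j. P\<inverse> `` {j})"
  have sub: "P \<subseteq> board n" using cfg unfolding penult_config_def by blast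
  note fin = finite_board_subset[OF sub]
  have "P \<subseteq> ?R \<union> ?C\<inverse>"
    using cfg sub unfolding penult_config_def light_rows_def board_def by fastforce
  moreover have "finite (?R \<union> ?C\<inverse>)" using fin by auto
  ultimately have "card P \<le> card (?R \<union> ?C\<inverse>)" by (rule card_mono[rotated])
  also have "\<dots> \<le> card ?R + card ?C"
    using card_Un_le[of ?R "?C\<inverse>"] by simp
  also have "card ?R = (\<Sum>i\<in>?A. card (P `` {i}))" using fin by (intro card_SigmaI) auto
  also have "\<dots> = 2 * card ?A" by (simp add: light_rows_def)
  also have "card ?C = (\<Sum>j\<in>?B. card (P\<inverse> `` {j}))" using fin by (intro card_SigmaI) auto
  also have "\<dots> = 2 * card ?B" by (simp add: light_rows_def)
  finally show ?thesis .
qed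

lemma config_card_cases:
  assumes cfg: "penult_config n P"
  shows "card P = 2 * n \<or> card P \<le> 3 * (n - 1) \<or> card P \<le> 4 * (n - 2)"
proof -
  note cfg' = penult_config_converse[OF cfg]
  let ?a = "card (light_rows n P)" and ?b = "card (light_rows n (P\<inverse>))"
  have "?a \<le> n" "?b \<le> n" by simp_all
  then consider "?a = n" | "?b = n" | "Suc ?a = n" "?b < n" | "Suc ?b = n" "?a < n"
    | "?a \<le> n - 2" "?b \<le> n - 2"
    by linarith
  then show ?thesis
  proof cases
    case 1
    then show ?thesis using card_all_rows_light[OF cfg] by simp
  next
    case 2
    then show ?thesis using card_all_rows_light[OF cfg'] by simp
  next
    case 3
    then show ?thesis using card_one_heavy_row[OF cfg] by simp
  next
    case 4
    then show ?thesis using card_one_heavy_row[OF cfg'] by simp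
  next
    case 5
    then show ?thesis using card_le_light_lines[OF cfg] by linarith
  qed
qed

section \<open>Constructions\<close>

text \<open>Column degrees of a set listed by rows are awkward to compute, so the columns \<open>C\<close> are
  supplied alongside the rows \<open>R\<close> and only their compatibility has to be checked.\<close>

lemma config_SigmaI:
  assumes rc: "\<And>i j. i < n \<Longrightarrow> j < n \<Longrightarrow> j \<in> R i \<longleftrightarrow> i \<in> C j"
    and R: "\<And>i. i < n \<Longrightarrow> R i \<subseteq> {..<n} \<and> 2 \<le> card (R i)"
    and C: "\<And>j. j < n \<Longrightarrow> C j \<subseteq> {..<n} \<and> 2 \<le> card (C j)"
    and light: "\<And>i j. i < n \<Longrightarrow> j \<in> R i \<Longrightarrow> card (R i) = 2 \<or> card (C j) = 2"
  shows "penult_config n (Sigma {..<n} R)" "card (Sigma {..<n} R) = (\<Sum>i<n. card (R i))"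
proof -
  let ?P = "Sigma {..<n} R"
  have row: "?P `` {i} = R i" if "i < n" for i using that by auto
  have col: "?P\<inverse> `` {j} = C j" if "j < n" for j
  proof
    show "?P\<inverse> `` {j} \<subseteq> C j" using rc that by auto
    show "C j \<subseteq> ?P\<inverse> `` {j}" using rc C[OF that] that by auto
  qed
  have sub: "?P \<subseteq> board n" using R unfolding board_def by fastforce
  have "card (?P `` {i}) = 2 \<or> card (?P\<inverse> `` {j}) = 2" if "(i, j) \<in> ?P" for i j
    using that light[of i j] row[of i] col[of j] sub unfolding board_def by auto
  then show "penult_config n ?P"
    using sub R C row col unfolding penult_config_def by auto
  have "card ?P = (\<Sum>i<n. card (?P `` {i}))" by (rule card_eq_sum_rows[OF sub])
  also have "\<dots> = (\<Sum>i<n. card (R i))" using row by (intro sum.cong) auto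
  finally show "card ?P = (\<Sum>i<n. card (R i))" .
qed

text \<open>The layout after \<open>k\<close> exchanges through line 0, adding the diagonal tokens \<open>(i, i)\<close> with
  \<open>2 \<le> i < 2 + k\<close>, and \<open>l\<close> exchanges through line 1, adding the tokens \<open>(i, i - 1)\<close> with
  \<open>3 \<le> i < 3 + l\<close>; the shift by one keeps the two families of added tokens disjoint.\<close>

definition layout_row :: "nat \<Rightarrow> nat \<Rightarrow> nat \<Rightarrow> nat \<Rightarrow> nat set" where
  "layout_row n k l i =
    (if i = 0 then {2 + k..<n} else if i = 1 then {2 + l..<n}
     else {if i < 2 + k then i else 0, if 3 \<le> i \<and> i < 3 + l then i - 1 else 1})"

definition layout_col :: "nat \<Rightarrow> nat \<Rightarrow> nat \<Rightarrow> nat \<Rightarrow> nat set" where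
  "layout_col n k l j =
    (if j = 0 then {2 + k..<n} else if j = 1 then insert 2 {3 + l..<n}
     else {if j < 2 + k then j else 0, if j < 2 + l then j + 1 else 1})"

lemma config_layout:
  assumes "k + 4 \<le> n" "l + 4 \<le> n"
  shows "\<exists>P. penult_config n P \<and> card P + k + l = 4 * (n - 2)"
proof -
  let ?R = "layout_row n k l" and ?C = "layout_col n k l"
  have light_row: "card (?R i) = 2" if "2 \<le> i" for i
    using that unfolding layout_row_def by (auto simp: card_insert_if)
  have light_col: "card (?C j) = 2" if "2 \<le> j" for j
    using that unfolding layout_col_def by (auto simp: card_insert_if)
  have rows: "?R i \<subseteq> {..<n} \<and> 2 \<le> card (?R i)" if "i < n" for i
    using that assms light_row[of i] unfolding layout_row_def by (cases "2 \<le> i") auto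
  have cols: "?C j \<subseteq> {..<n} \<and> 2 \<le> card (?C j)" if "j < n" for j
    using that assms light_col[of j] unfolding layout_col_def by (cases "2 \<le> j") auto
  have rc: "j \<in> ?R i \<longleftrightarrow> i \<in> ?C j" if "i < n" "j < n" for i j
    using that unfolding layout_row_def layout_col_def by auto
  have light: "card (?R i) = 2 \<or> card (?C j) = 2" if "i < n" "j \<in> ?R i" for i j
  proof (cases "2 \<le> i")
    case True
    then show ?thesis using light_row by simp
  next
    case False
    with that(2) have "2 \<le> j" unfolding layout_row_def by (auto split: if_splits)
    then show ?thesis using light_col by simp
  qed
  note cfg = config_SigmaI[of n ?R ?C, OF rc rows cols light]
  obtain m where m: "n = Suc (Suc m)"
    using assms(1) by (metis add_2_eq_Suc le_add_diff_inverse add_leD2 numeral_Bit0 add.assoc le_trans le_add1)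
  have "(\<Sum>i<n. card (?R i)) = card (?R 0) + card (?R 1) + (\<Sum>i<m. card (?R (Suc (Suc i))))"
    unfolding m by (simp only: sum.lessThan_Suc_shift) simp
  also have "(\<Sum>i<m. card (?R (Suc (Suc i)))) = 2 * m"
    using light_row by simp
  finally have "card (Sigma {..<n} ?R) + k + l = 4 * (n - 2)"
    using cfg(2) assms m by (simp add: layout_row_def)
  with cfg(1) show ?thesis by blast
qed

lemma config_between:
  assumes "4 \<le> n" "2 * n \<le> x" "x \<le> 4 * (n - 2)"
  shows "\<exists>P. penult_config n P \<and> card P = x"
proof -
  \<comment> \<open>\<open>d\<close> exchanges are needed; as many as possible go through line 0, the rest through line 1.\<close>
  define d where "d = 4 * (n - 2) - x"
  have "min d (n - 4) + 4 \<le> n" "d - min d (n - 4) + 4 \<le> n"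
    using assms unfolding d_def by auto
  from config_layout[OF this] obtain P
    where "penult_config n P" "card P + min d (n - 4) + (d - min d (n - 4)) = 4 * (n - 2)"
    by blast
  then show ?thesis using assms unfolding d_def by (intro exI[of _ P]) auto
qed

lemma config_2: "\<exists>P. penult_config 2 P \<and> card P = 4"
proof -
  let ?R = "\<lambda>i::nat. {..<2::nat}"
  have "penult_config 2 (Sigma {..<2} ?R) \<and> card (Sigma {..<2} ?R) = 4"
    using config_SigmaI[of 2 ?R ?R] by simp
  then show ?thesis by blast
qed

lemma config_3: "\<exists>P. penult_config 3 P \<and> card P = 6"
proof -
  let ?R = "\<lambda>i::nat. {..<3} - {i}"
  have row: "?R i \<subseteq> {..<3} \<and> card (?R i) = 2" if "i < 3" for i
    using that by auto
  have "penult_config 3 (Sigma {..<3} ?R)" "card (Sigma {..<3} ?R) = (\<Sum>i<3. card (?R i))"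
    by (rule config_SigmaI[of 3 ?R ?R]; use row in auto)+
  moreover have "(\<Sum>i<3. card (?R i)) = (\<Sum>i<3::nat. 2)"
    using row by (intro sum.cong) auto
  ultimately show ?thesis by (intro exI[of _ "Sigma {..<3} ?R"]) simp
qed

text \<open>Row 0 and column 0 are the only heavy lines; the extremal case of
  \<open>card_one_heavy_row\<close>.\<close>

lemma config_4_9: "\<exists>P. penult_config 4 P \<and> card P = 9"
proof -
  let ?R = "\<lambda>i::nat. if i = 0 then {1..<4} else {0, i}"
  have row: "?R i \<subseteq> {..<4} \<and> card (?R i) = (if i = 0 then 3 else 2)" if "i < 4" for i
    using that by auto
  have rc: "j \<in> ?R i \<longleftrightarrow> i \<in> ?R j" if "i < 4" "j < 4" for i j
    using that by auto
  have light: "card (?R i) = 2 \<or> card (?R j) = 2" if "i < 4" "j \<in> ?R i" for i j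
    using that by (cases "i = 0") auto
  have ge: "?R i \<subseteq> {..<4} \<and> 2 \<le> card (?R i)" if "i < 4" for i
    using row[OF that] by (simp split: if_splits)
  note cfg = config_SigmaI[of 4 ?R ?R, OF rc ge ge light]
  have "(\<Sum>i<4. card (?R i)) = (\<Sum>i<4::nat. if i = 0 then 3 else 2)"
    using row by (intro sum.cong) auto
  also have "\<dots> = 9" by (simp add: eval_nat_numeral)
  finally show ?thesis
    using cfg by (intro exI[of _ "Sigma {..<4} ?R"]) simp
qed

section \<open>The sizes of penults\<close>

theorem mainTheorem1:
  shows "penult_sizes 2 = {4} \<and>
         penult_sizes 3 = {6} \<and>
         penult_sizes 4 = {8, 9} \<and>
         (\<forall>n\<ge>5. penult_sizes n = {x::int. 2 * int n \<le> x \<and> x \<le> 4 * (int n - 2)})"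
proof (intro conjI allI impI)
  have bounds: "2 * n \<le> card P \<and> (card P = 2 * n \<or> card P \<le> 3 * (n - 1) \<or> card P \<le> 4 * (n - 2))"
    if "penult_config n P" for n P
    using config_card_ge[OF that] config_card_cases[OF that] by simp
  have sizeI: "int x \<in> penult_sizes n" if "n > 0" "\<exists>P. penult_config n P \<and> card P = x" for n x
    using that penult_sizes_eq by auto
  show "penult_sizes 2 = {4}"
    using bounds[of 2] sizeI[OF _ config_2] by (fastforce simp: penult_sizes_eq)
  show "penult_sizes 3 = {6}"
    using bounds[of 3] sizeI[OF _ config_3] by (fastforce simp: penult_sizes_eq)
  have "penult_sizes 4 \<subseteq> {8, 9}"
    using bounds[of 4] by (fastforce simp: penult_sizes_eq)
  then show "penult_sizes 4 = {8, 9}"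
    using sizeI[OF _ config_between[of 4 8]] sizeI[OF _ config_4_9] by auto
  fix n :: nat
  assume n: "5 \<le> n"
  show "penult_sizes n = {x. 2 * int n \<le> x \<and> x \<le> 4 * (int n - 2)}"
  proof (intro equalityI subsetI)
    fix x
    assume "x \<in> penult_sizes n"
    then obtain P where "penult_config n P" "x = int (card P)"
      using n penult_sizes_eq by auto
    then show "x \<in> {x. 2 * int n \<le> x \<and> x \<le> 4 * (int n - 2)}"
      using bounds[of n P] n by auto
  next
    fix x
    assume "x \<in> {x. 2 * int n \<le> x \<and> x \<le> 4 * (int n - 2)}"
    then have "x = int (nat x)" "2 * n \<le> nat x" "nat x \<le> 4 * (n - 2)"
      using n by auto
    then show "x \<in> penult_sizes n"
      using sizeI[OF _ config_between[of n "nat x"]] n by simp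
  qed
qed

end
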